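(* Let $p$ and $q$ be monic real-rooted polynomials of degree $n$, each with simple roots, having a common interlacer. Let $\lambda_1>\dots>\lambda_n$ be the roots of $p$ and $\mu_1>\dots>\mu_n$ the roots of $q$, and assume $\sum_{i=1}^n\lambda_i=\sum_{i=1}^n\mu_i$. If $$\sum_{i=1}^{k} \frac{q(\lambda_i)}{p'(\lambda_i)} \ge 0 \qquad \text{for all integers } 1\le k<n,$$ then $p \succeq q$ (that is, $p$ majorizes $q$).
   Context: Roots are always listed in nonincreasing order. Majorization: for real vectors $a_1\ge\dots\ge a_n$ and $b_1\ge\dots\ge b_n$, $a\succeq b$ means $\sum_{i=1}^k a_i\ge\sum_{i=1}^k b_i$ for all $k\le n$ and $\sum_{i=1}^n a_i=\sum_{i=1}^n b_i$. For real-rooted polynomials of degree $n$ with ordered root vectors $\lambda$ (of $p$) and $\mu$ (of $q$), $p\succeq q$ ($p$ majorizes $q$) means $\lambda\succeq\mu$. Common interlacer: $p$ and $q$ have a common interlacer if there is a third polynomial interlacing both; explicitly, the closed intervals with endpoints $\lambda_i,\mu_i$ ($1\le i\le n$) are non-crossing, i.e. $\max(\lambda_{i+1},\mu_{i+1})\le\min(\lambda_i,\mu_i)$ for $1\le i<n$. *)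

theory Defs
  imports "HOL-Computational_Algebra.Computational_Algebra"
begin

definition real_rooted :: "real poly \<Rightarrow> bool" where
  "real_rooted p \<longleftrightarrow> p \<noteq> 0 \<and> (\<forall>z::complex. poly (map_poly of_real p) z = 0 \<longrightarrow> z \<in> \<real>)"

definition root_list :: "real poly \<Rightarrow> real list" where
  "root_list p = rev (sorted_list_of_multiset (proots p))"

text \<open>The roots, counted with multiplicity, are indexed from 1 in nonincreasing order:
  \<open>ordered_root p 1 \<ge> \<dots> \<ge> ordered_root p n\<close>. This is meaningful for real-rooted
  polynomials of degree \<open>n\<close> and indices from 1 to \<open>n\<close> only.\<close>

definition ordered_root :: "real poly \<Rightarrow> nat \<Rightarrow> real" where
  "ordered_root p i = root_list p ! (i - 1)"

text \<open>Vectors of length \<open>n\<close> are functions on \<open>{1..n}\<close>, assumed nonincreasing there.\<close>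

definition vec_majorizes :: "nat \<Rightarrow> (nat \<Rightarrow> real) \<Rightarrow> (nat \<Rightarrow> real) \<Rightarrow> bool" where
  "vec_majorizes n a b \<longleftrightarrow>
     (\<forall>k\<le>n. (\<Sum>i=1..k. a i) \<ge> (\<Sum>i=1..k. b i)) \<and> (\<Sum>i=1..n. a i) = (\<Sum>i=1..n. b i)"

definition poly_majorizes :: "real poly \<Rightarrow> real poly \<Rightarrow> bool" where
  "poly_majorizes p q \<longleftrightarrow>
     real_rooted p \<and> real_rooted q \<and> degree p = degree q \<and>
     vec_majorizes (degree p) (ordered_root p) (ordered_root q)"

text \<open>The intervals between the \<open>i\<close>-th roots of \<open>p\<close> and \<open>q\<close> are non-crossing.
  The lemma \<open>common_interlacer_iff\<close> below shows that this is the existence of a polynomial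
  interlacing both.\<close>

definition common_interlacer :: "real poly \<Rightarrow> real poly \<Rightarrow> bool" where
  "common_interlacer p q \<longleftrightarrow>
     real_rooted p \<and> real_rooted q \<and> degree p = degree q \<and>
     (\<forall>i. 1 \<le> i \<and> i < degree p \<longrightarrow>
        max (ordered_root p (i + 1)) (ordered_root q (i + 1)) \<le>
        min (ordered_root p i) (ordered_root q i))"

definition interlaces :: "real poly \<Rightarrow> real poly \<Rightarrow> bool" where
  "interlaces r p \<longleftrightarrow>
     real_rooted r \<and> real_rooted p \<and> degree p = degree r + 1 \<and>
     (\<forall>i. 1 \<le> i \<and> i < degree p \<longrightarrow>
        ordered_root p (i + 1) \<le> ordered_root r i \<and> ordered_root r i \<le> ordered_root p i)"

lemma map_poly_of_real_mult:
  "map_poly (of_real :: real \<Rightarrow> complex) (p * q) = map_poly of_real p * map_poly of_real q"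
  by (intro poly_eqI) (simp add: coeff_map_poly coeff_mult)

lemma map_poly_of_real_linear:
  "map_poly (of_real :: real \<Rightarrow> complex) [:a, 1:] = [:of_real a, 1:]"
  by (simp add: map_poly_pCons)

lemma poly_map_poly_of_real:
  "poly (map_poly (of_real :: real \<Rightarrow> complex) p) (of_real x) = of_real (poly p x)"
  by (induction p) (auto simp: map_poly_pCons)

lemma size_proots_real_rooted:
  assumes "real_rooted p"
  shows "size (proots p) = degree p"
  using assms
proof (induction "degree p" arbitrary: p)
  case 0
  then obtain c where "p = [:c:]" by (metis degree_eq_zeroE)
  then show ?case by simp
next
  case (Suc n)
  let ?c = "map_poly (of_real :: real \<Rightarrow> complex)"
  have "degree (?c p) = degree p" by (simp add: degree_map_poly)
  then have "\<not> constant (poly (?c p))"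
    using Suc(2) by (simp add: constant_degree)
  then obtain z where z: "poly (?c p) z = 0"
    using fundamental_theorem_of_algebra by blast
  then obtain x where x: "z = of_real x"
    using Suc.prems unfolding real_rooted_def by (metis Reals_cases)
  then have "poly p x = 0" using z by (simp add: poly_map_poly_of_real)
  then obtain q where q: "p = [:-x, 1:] * q" by (metis dvdE poly_eq_0_iff_dvd)
  have q0: "q \<noteq> 0" using Suc.prems q by (auto simp: real_rooted_def)
  have rq: "real_rooted q"
    using Suc.prems q q0 unfolding real_rooted_def
    by (auto simp: map_poly_of_real_mult simp del: mult_pCons_left)
  have d: "degree p = Suc (degree q)" using q q0 by (simp add: degree_mult_eq del: mult_pCons_left)
  have "size (proots q) = degree q" using Suc(1) Suc(2) d rq by simp
  moreover have "proots p = {#x#} + proots q"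
    using q q0 by (subst q, subst proots_mult) (simp_all del: mult_pCons_left)
  ultimately show ?case using d by simp
qed

lemma length_root_list: "real_rooted p \<Longrightarrow> length (root_list p) = degree p"
  unfolding root_list_def by (metis length_rev mset_sorted_list_of_multiset size_mset
      size_proots_real_rooted)

lemma exists_poly_with_root_list:
  assumes "sorted (rev xs)"
  shows "\<exists>r. real_rooted r \<and> degree r = length xs \<and> root_list r = xs"
proof -
  have "\<exists>r. real_rooted r \<and> degree r = length xs \<and> proots r = mset xs" for xs :: "real list"
  proof (induction xs)
    case Nil
    show ?case by (rule exI[of _ 1]) (simp add: real_rooted_def)
  next
    case (Cons x xs)
    then obtain r where r: "real_rooted r" "degree r = length xs" "proots r = mset xs" by blast
    have r0: "r \<noteq> 0" using r by (simp add: real_rooted_def)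
    have "real_rooted ([:-x, 1:] * r)"
      unfolding real_rooted_def
    proof (intro conjI allI impI)
      show "[:-x, 1:] * r \<noteq> 0" using r0 by (simp del: mult_pCons_left)
      fix z :: complex
      assume "poly (map_poly of_real ([:-x, 1:] * r)) z = 0"
      then have "z = of_real x \<or> poly (map_poly of_real r) z = 0"
        by (simp add: map_poly_of_real_mult map_poly_of_real_linear del: mult_pCons_left)
      then show "z \<in> \<real>" using r by (auto simp: real_rooted_def)
    qed
    moreover have "degree ([:-x, 1:] * r) = length (x # xs)"
      using r r0 by (simp add: degree_mult_eq del: mult_pCons_left)
    moreover have "proots ([:-x, 1:] * r) = mset (x # xs)"
      using r r0 by (subst proots_mult) (simp_all del: mult_pCons_left)
    ultimately show ?case by blast
  qed
  from this[of xs] obtain r where r: "real_rooted r" "degree r = length xs" "proots r = mset xs"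
    by blast
  have "sorted_list_of_multiset (mset xs) = rev xs"
    using assms by (simp add: sorted_sort_id properties_for_sort)
  then show ?thesis using r by (intro exI[of _ r]) (simp add: root_list_def)
qed

lemma ordered_root_antimono:
  assumes "real_rooted p" "1 \<le> i" "i \<le> j" "j \<le> degree p"
  shows "ordered_root p j \<le> ordered_root p i"
proof -
  have "sorted (rev (root_list p))" by (simp add: root_list_def)
  then have "sorted_wrt (\<ge>) (root_list p)" by (simp add: sorted_wrt_rev)
  then show ?thesis
    using assms length_root_list[OF assms(1)]
    by (cases "i = j") (auto simp: ordered_root_def sorted_wrt_iff_nth_less)
qed

lemma common_interlacer_iff:
  assumes "degree p > 0"
  shows "common_interlacer p q \<longleftrightarrow> (\<exists>r. interlaces r p \<and> interlaces r q)"
proof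
  assume c: "common_interlacer p q"
  then have rr: "real_rooted p" "real_rooted q" and d: "degree p = degree q"
    and le: "\<And>i. 1 \<le> i \<Longrightarrow> i < degree p \<Longrightarrow>
        max (ordered_root p (i + 1)) (ordered_root q (i + 1)) \<le>
        min (ordered_root p i) (ordered_root q i)"
    unfolding common_interlacer_def by auto
  define f where "f i = max (ordered_root p (i + 2)) (ordered_root q (i + 2))" for i
  define xs where "xs = map f [0..<degree p - 1]"
  have "f j \<le> f i" if "i \<le> j" "j < degree p - 1" for i j
    unfolding f_def using that d rr by (intro max.mono ordered_root_antimono) auto
  then have "sorted_wrt (\<ge>) xs"
    by (auto simp: xs_def sorted_wrt_iff_nth_less)
  then have "sorted (rev xs)" by (simp add: sorted_wrt_rev)
  then obtain r where r: "real_rooted r" "degree r = length xs" "root_list r = xs"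
    using exists_poly_with_root_list by blast
  have o: "ordered_root r i = max (ordered_root p (i + 1)) (ordered_root q (i + 1))"
    if "1 \<le> i" "i < degree p" for i
    using that r by (simp add: ordered_root_def[of r] xs_def f_def)
  have "interlaces r p \<and> interlaces r q"
    unfolding interlaces_def using rr r d assms le o by (auto simp: xs_def)
  then show "\<exists>r. interlaces r p \<and> interlaces r q" by blast
next
  assume "\<exists>r. interlaces r p \<and> interlaces r q"
  then obtain r where r: "interlaces r p" "interlaces r q" by blast
  show "common_interlacer p q"
    unfolding common_interlacer_def
  proof (intro conjI allI impI)
    show "real_rooted p" "real_rooted q" "degree p = degree q"
      using r by (auto simp: interlaces_def)
    fix i assume "1 \<le> i \<and> i < degree p"
    then have "ordered_root p (i + 1) \<le> ordered_root r i" "ordered_root r i \<le> ordered_root p i"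
      "ordered_root q (i + 1) \<le> ordered_root r i" "ordered_root r i \<le> ordered_root q i"
      using r by (auto simp: interlaces_def)
    then show "max (ordered_root p (i + 1)) (ordered_root q (i + 1)) \<le>
        min (ordered_root p i) (ordered_root q i)" by simp
  qed
qed

end

theory Submission
  imports Defs
begin

text \<open>
  Join \<open>p\<close> to \<open>q\<close> by the straight pencil \<open>p\<^sub>t = p + t r\<close>, where \<open>r = q - p\<close>. Suppose
  first that no root of \<open>p\<close> is a root of \<open>q\<close>. The \<open>n\<close> intervals between \<open>\<lambda>\<^sub>i\<close> and \<open>\<mu>\<^sub>i\<close> are then
  disjoint, each contains exactly one root \<open>x\<^sub>i(t)\<close> of \<open>p\<^sub>t\<close>, and this root travels from \<open>\<lambda>\<^sub>i\<close> to
  \<open>\<mu>\<^sub>i\<close>. Its velocity is \<open>- c\<^sub>i\<close>, where \<open>c\<^sub>i = r(x\<^sub>i) / p\<^sub>t'(x\<^sub>i)\<close> is the residue of \<open>r / p\<^sub>t\<close> at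
  \<open>x\<^sub>i\<close>; at time \<open>0\<close> it is the number \<open>q(\<lambda>\<^sub>i) / p'(\<lambda>\<^sub>i)\<close> of the hypothesis. So the sum of the
  \<open>k\<close> largest roots changes at the rate \<open>- S\<^sub>k\<close> with \<open>S\<^sub>k = c\<^sub>1 + \<dots> + c\<^sub>k\<close>, and it is enough that
  the condition \<open>S\<^sub>k \<ge> 0\<close>, given at time \<open>0\<close>, persists.

  It persists because the residues satisfy \<open>c\<^sub>i' = - 2 \<Sum>\<^sub>j c\<^sub>i c\<^sub>j / (x\<^sub>i - x\<^sub>j)\<close>, the sum being over
  \<open>j \<noteq> i\<close> (\<open>c_derivative\<close>). Summing over \<open>i \<le> k\<close>, the pairs with both indices at most \<open>k\<close>
  cancel, and \<open>S\<^sub>k' = - 2 \<Sum> c\<^sub>i c\<^sub>j / (x\<^sub>i - x\<^sub>j)\<close> over \<open>i \<le> k < j\<close>. At a moment when all partial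
  sums are nonnegative and \<open>S\<^sub>k = 0\<close>, summation by parts in both indices shows that this
  is positive (\<open>cross_sum_neg\<close>), because the mixed second difference of \<open>1 / (x - y)\<close> has
  constant sign. Hence no \<open>S\<^sub>k\<close> can cross zero downwards (\<open>nonneg_barrier\<close>). The strict inequality uses
  that no \<open>c\<^sub>i\<close> vanishes, which is where the absence of common roots enters a second time.

  Common roots are removed one at a time (\<open>interlaced_partial_sum_le\<close>): dividing \<open>p\<close> and \<open>q\<close>
  by a common factor does not change \<open>q / p\<close>, hence not the residues, and the interlacing
  condition forces the two positions of a common root to differ by at most one.
\<close>

section \<open>Lagrange interpolation and residues\<close>

definition root_poly :: "('a \<Rightarrow> real) \<Rightarrow> 'a set \<Rightarrow> real poly" where
  "root_poly x A = (\<Prod>i\<in>A. [:- x i, 1:])"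

lemma poly_root_poly: "poly (root_poly x A) y = (\<Prod>i\<in>A. y - x i)"
  by (simp add: root_poly_def poly_prod)

lemma degree_root_poly: "finite A \<Longrightarrow> degree (root_poly x A) = card A"
  by (simp add: root_poly_def degree_prod_eq_sum_degree)

lemma lead_coeff_root_poly: "lead_coeff (root_poly x A) = 1"
  by (simp add: root_poly_def lead_coeff_prod)

lemma pderiv_root_poly:
  "poly (pderiv (root_poly x A)) y = (\<Sum>i\<in>A. \<Prod>j\<in>A - {i}. y - x j)"
  by (simp add: root_poly_def pderiv_prod poly_sum poly_prod pderiv_pCons)

lemma pderiv_root_poly_at_root:
  assumes "finite A" "i \<in> A"
  shows "poly (pderiv (root_poly x A)) (x i) = (\<Prod>j\<in>A - {i}. x i - x j)"
proof -
  have "(\<Prod>j\<in>A - {a}. x i - x j) = 0" if "a \<in> A - {i}" for a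
    using assms that by (intro prod_zero) auto
  then have "(\<Sum>a\<in>A - {i}. \<Prod>j\<in>A - {a}. x i - x j) = 0"
    by (intro sum.neutral) blast
  then show ?thesis
    using assms by (simp add: pderiv_root_poly sum.remove[of A i])
qed

lemma eq_root_polyI:
  assumes "finite A" "inj_on x A" "degree q = card A" "lead_coeff q = 1"
    and "\<And>i. i \<in> A \<Longrightarrow> poly q (x i) = 0"
  shows "q = root_poly x A"
proof (rule poly_eqI_degree_lead_coeff[where n = "card A" and A = "x ` A"])
  show "poly.coeff q (card A) = poly.coeff (root_poly x A) (card A)"
    using assms lead_coeff_root_poly[of x A] by (simp add: degree_root_poly)
qed (use assms in \<open>auto simp: card_image degree_root_poly poly_root_poly\<close>)

lemma coeff_root_poly:
  assumes "card A = Suc d"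
  shows "coeff (root_poly x A) d = - (\<Sum>i\<in>A. x i)"
proof -
  have "finite A" using assms by (metis card.infinite nat.distinct(1))
  then show ?thesis
    using assms
  proof (induction A arbitrary: d rule: finite_induct)
    case (insert a A)
    have rp: "root_poly x (insert a A) = [:- x a, 1:] * root_poly x A"
      using insert by (simp add: root_poly_def)
    have top: "coeff (root_poly x A) d = 1"
      using lead_coeff_root_poly[of x A] insert by (simp add: degree_root_poly)
    show ?case
    proof (cases d)
      case 0
      then have "A = {}" using insert by simp
      then show ?thesis using 0 by (simp add: root_poly_def)
    next
      case (Suc e)
      then show ?thesis using insert top by (simp add: rp)
    qed
  qed simp
qed

text \<open>When \<open>x\<close> is injective on \<open>A\<close>, this is the residue of the rational function
  \<open>r / root_poly x A\<close> at its simple pole \<open>x i\<close>.\<close>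

definition residue_at :: "real poly \<Rightarrow> ('a \<Rightarrow> real) \<Rightarrow> 'a set \<Rightarrow> 'a \<Rightarrow> real" where
  "residue_at r x A i = poly r (x i) / (\<Prod>j\<in>A - {i}. x i - x j)"

lemma prod_diff_nonzero:
  fixes x :: "'a \<Rightarrow> real"
  assumes "inj_on x A" "finite A" "i \<in> A"
  shows "(\<Prod>j\<in>A - {i}. x i - x j) \<noteq> 0"
  using assms by (auto simp: inj_on_def)

lemma lagrange_interpolation:
  assumes "finite A" "inj_on x A" "degree r < card A"
  shows "r = (\<Sum>i\<in>A. smult (residue_at r x A i) (root_poly x (A - {i})))"
proof (rule poly_eqI_degree[where A = "x ` A"])
  let ?s = "\<Sum>i\<in>A. smult (residue_at r x A i) (root_poly x (A - {i}))"
  have c: "card A > 0" using assms by linarith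
  show "degree r < card (x ` A)" using assms by (simp add: card_image)
  have "degree ?s \<le> card A - 1"
    by (rule degree_sum_le)
       (use assms in \<open>auto intro!: order_trans[OF degree_smult_le] simp: degree_root_poly\<close>)
  then show "degree ?s < card (x ` A)" using c assms by (simp add: card_image)
  fix y assume "y \<in> x ` A"
  then obtain i where i: "i \<in> A" "y = x i" by blast
  have z: "(\<Prod>j\<in>A - {a}. x i - x j) = 0" if "a \<in> A - {i}" for a
    using assms that i by (intro prod_zero) auto
  have nz: "(\<Prod>j\<in>A - {i}. x i - x j) \<noteq> 0"
    using prod_diff_nonzero[OF assms(2,1) i(1)] .
  have "(\<Sum>a\<in>A - {i}. residue_at r x A a * (\<Prod>j\<in>A - {a}. x i - x j)) = 0"
    by (intro sum.neutral) (use z in auto)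
  then have "poly ?s y = residue_at r x A i * (\<Prod>j\<in>A - {i}. x i - x j)"
    using assms i by (simp add: poly_sum poly_root_poly sum.remove[of A i])
  then show "poly r y = poly ?s y"
    using nz i by (simp add: residue_at_def)
qed

text \<open>The residues add up to the coefficient of \<open>1 / y\<close> in the expansion of
  \<open>r / root_poly x A\<close> at infinity, which is read off from the interpolation formula as the
  coefficient of \<open>r\<close> one degree below \<open>card A\<close>.\<close>

lemma sum_residues_eq_0:
  assumes "finite A" "inj_on x A" "Suc (degree r) < card A \<or> r = 0"
  shows "(\<Sum>i\<in>A. residue_at r x A i) = 0"
proof (cases "r = 0")
  case False
  obtain d where d: "card A = Suc d" using assms False by (cases "card A") auto
  have "coeff r d = (\<Sum>i\<in>A. residue_at r x A i * coeff (root_poly x (A - {i})) d)"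
    using assms False by (subst lagrange_interpolation[OF assms(1,2)]) (auto simp: coeff_sum)
  also have "\<dots> = (\<Sum>i\<in>A. residue_at r x A i)"
  proof (rule sum.cong[OF refl])
    fix i assume "i \<in> A"
    then have "degree (root_poly x (A - {i})) = d"
      using assms d by (simp add: degree_root_poly)
    then show "residue_at r x A i * coeff (root_poly x (A - {i})) d = residue_at r x A i"
      using lead_coeff_root_poly[of x "A - {i}"] by simp
  qed
  moreover have "coeff r d = 0" using assms False d by (intro coeff_eq_0) auto
  ultimately show ?thesis by simp
qed (simp add: residue_at_def)

text \<open>This turns the derivative of \<open>r\<close> into an expression in the residues alone, so that
  the motion of the residues becomes a closed system. It comes from differentiating the
  interpolation formula: at \<open>x i\<close> the \<open>j\<close>-th summand contributes a single product when
  \<open>j \<noteq> i\<close>, and the \<open>i\<close>-th one contributes a product for every other node.\<close>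

lemma pderiv_at_node:
  assumes A: "finite A" "inj_on x A" "degree r < card A" and i: "i \<in> A"
  defines "c \<equiv> residue_at r x A"
  shows "poly (pderiv r) (x i) =
    (\<Prod>j\<in>A - {i}. x i - x j) * (\<Sum>j\<in>A - {i}. (c i + c j) / (x i - x j))"
proof -
  let ?V = "\<Prod>j\<in>A - {i}. x i - x j"
  have V: "(\<Prod>l\<in>A - {i} - {j}. x i - x l) = ?V / (x i - x j)" if "j \<in> A - {i}" for j
    using that A i by (subst prod.remove[of "A - {i}" j]) (auto simp: inj_on_def)
  have other: "poly (pderiv (root_poly x (A - {j}))) (x i) = ?V / (x i - x j)"
    if "j \<in> A - {i}" for j
  proof -
    have "A - {j} - {i} = A - {i} - {j}" by blast
    then show ?thesis
      using pderiv_root_poly_at_root[of "A - {j}" i x] V[OF that] that A i by auto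
  qed
  have own: "poly (pderiv (root_poly x (A - {i}))) (x i) = (\<Sum>j\<in>A - {i}. ?V / (x i - x j))"
    by (simp add: pderiv_root_poly V)
  have "poly (pderiv r) (x i) = (\<Sum>j\<in>A. c j * poly (pderiv (root_poly x (A - {j}))) (x i))"
    by (subst lagrange_interpolation[OF A])
       (simp add: c_def poly_sum higher_pderiv_sum[where n = 1, simplified] pderiv_smult)
  also have "\<dots> = c i * (\<Sum>j\<in>A - {i}. ?V / (x i - x j)) + (\<Sum>j\<in>A - {i}. c j * (?V / (x i - x j)))"
    using A i by (simp add: sum.remove[of A i] own other)
  also have "\<dots> = ?V * (\<Sum>j\<in>A - {i}. (c i + c j) / (x i - x j))"
    unfolding sum_distrib_left sum.distrib[symmetric]
    by (intro sum.cong refl) (simp add: field_simps add_divide_distrib)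
  finally show ?thesis .
qed

section \<open>Summation by parts\<close>

text \<open>Abel summation, run as an induction on the claim that \<open>(\<Sum>i\<le>k. c i) * h k\<close> is at most
  \<open>\<Sum>i\<le>k. c i * h i\<close>, strictly as soon as \<open>k > 0\<close>. Lowering the weight \<open>h k\<close> to \<open>h (Suc k)\<close>
  only decreases the left-hand side, and the first such step is strict because \<open>c 0 > 0\<close>.\<close>

lemma sum_mult_decreasing_pos:
  fixes c h :: "nat \<Rightarrow> real"
  assumes partial: "\<And>k. k \<le> n \<Longrightarrow> 0 \<le> (\<Sum>i<k. c i)"
    and total: "(\<Sum>i<n. c i) = 0" and first: "0 < c 0" and "0 < n"
    and h: "\<And>i. Suc i < n \<Longrightarrow> h (Suc i) < h i"
  shows "0 < (\<Sum>i<n. c i * h i)"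
proof -
  have "(\<Sum>i<Suc k. c i) * h k \<le> (\<Sum>i<Suc k. c i * h i) \<and>
      (0 < k \<longrightarrow> (\<Sum>i<Suc k. c i) * h k < (\<Sum>i<Suc k. c i * h i))" if "k < n" for k
    using that
  proof (induction k)
    case (Suc k)
    have hk: "h (Suc k) < h k" using h Suc by simp
    have p: "0 \<le> (\<Sum>i<Suc k. c i)" using partial[of "Suc k"] Suc.prems by linarith
    have w: "(\<Sum>i<Suc k. c i) * h (Suc k) \<le> (\<Sum>i<Suc k. c i) * h k"
      using hk p by (intro mult_left_mono) auto
    have "(\<Sum>i<Suc k. c i) * h (Suc k) < (\<Sum>i<Suc k. c i * h i)"
    proof (cases "k = 0")
      case True
      then show ?thesis using first hk by simp
    next
      case False
      then show ?thesis using Suc w by simp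
    qed
    then show ?case by (simp add: algebra_simps)
  qed simp
  from this[of "n - 1"] have *: "(\<Sum>i<n. c i) * h (n - 1) < (\<Sum>i<n. c i * h i)" if "1 < n"
    using that by (cases n) auto
  have "n \<noteq> 1" using total first by auto
  then show ?thesis using * total \<open>0 < n\<close> by simp
qed

text \<open>Both blocks \<open>i < k\<close> and \<open>i \<ge> k\<close> have total zero, nonnegative partial sums and a positive
  first entry, so that the previous lemma applies to each. Summing over \<open>i\<close> with weights
  \<open>- 1 / (x i - x j)\<close> gives a function \<open>G\<close> of \<open>j\<close>. The first application shows that \<open>G\<close> decreases,
  since the difference of two such weights is monotone in \<open>i\<close>; the second one takes \<open>G\<close> as
  the weight of the block \<open>j \<ge> k\<close>.\<close>

lemma cross_sum_neg:
  fixes c x :: "nat \<Rightarrow> real"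
  assumes partial: "\<And>j. j \<le> n \<Longrightarrow> 0 \<le> (\<Sum>i<j. c i)"
    and total: "(\<Sum>i<n. c i) = 0" and zero: "(\<Sum>i<k. c i) = 0" and k: "0 < k" "k < n"
    and nz: "\<And>i. i < n \<Longrightarrow> c i \<noteq> 0"
    and x: "\<And>i j. i < j \<Longrightarrow> j < n \<Longrightarrow> x j < x i"
  shows "(\<Sum>i<k. \<Sum>j\<in>{k..<n}. c i * c j / (x i - x j)) < 0"
proof -
  have split: "(\<Sum>i<j. c (k + i)) = (\<Sum>i<k + j. c i)" for j
    using zero by (induction j) auto
  define G where "G j = (\<Sum>i<k. c i * (- (1 / (x i - x j))))" for j
  have c0: "0 < c 0" using partial[of 1] nz[of 0] k by simp
  have ck: "0 < c k" using partial[of "Suc k"] nz[of k] k zero by simp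
  have G: "G (Suc j) < G j" if "k \<le> j" "Suc j < n" for j
  proof -
    have "0 < (\<Sum>i<k. c i * (1 / (x i - x (Suc j)) - 1 / (x i - x j)))"
    proof (rule sum_mult_decreasing_pos)
      fix i assume i: "Suc i < k"
      have o: "x (Suc j) < x j" "x j < x (Suc i)" "x (Suc i) < x i"
        using x that i k by auto
      have *: "1 / (u - x (Suc j)) - 1 / (u - x j) =
          - ((x j - x (Suc j)) / ((u - x j) * (u - x (Suc j))))" if "x j < u" for u
        using that o by (subst minus_divide_left, subst diff_frac_eq) simp_all
      have "(x (Suc i) - x j) * (x (Suc i) - x (Suc j)) < (x i - x j) * (x i - x (Suc j))"
        using o by (intro mult_strict_mono) auto
      then have "(x j - x (Suc j)) / ((x i - x j) * (x i - x (Suc j))) <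
          (x j - x (Suc j)) / ((x (Suc i) - x j) * (x (Suc i) - x (Suc j)))"
        using o by (intro divide_strict_left_mono) auto
      then show "1 / (x (Suc i) - x (Suc j)) - 1 / (x (Suc i) - x j) <
          1 / (x i - x (Suc j)) - 1 / (x i - x j)"
        using o by (subst (1 2) *) auto
    qed (use partial zero c0 k in auto)
    also have "\<dots> = G j - G (Suc j)"
      by (simp add: G_def sum_negf sum_subtractf right_diff_distrib)
    finally show ?thesis by simp
  qed
  have "0 < (\<Sum>j<n - k. c (k + j) * G (k + j))"
  proof (rule sum_mult_decreasing_pos)
    show "0 \<le> (\<Sum>i<j. c (k + i))" if "j \<le> n - k" for j
      using that k partial[of "k + j"] by (simp add: split)
  qed (use k ck total split G in auto)
  also have "\<dots> = (\<Sum>j\<in>{k..<n}. c j * G j)"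
    using k by (simp add: sum.atLeastLessThan_shift_0[of _ k] atLeast0LessThan)
  also have "\<dots> = (\<Sum>j\<in>{k..<n}. \<Sum>i<k. - (c i * c j / (x i - x j)))"
    by (simp add: G_def sum_distrib_left field_simps)
  also have "\<dots> = - (\<Sum>i<k. \<Sum>j\<in>{k..<n}. c i * c j / (x i - x j))"
    by (subst sum.swap) (simp add: sum_negf)
  finally show ?thesis by simp
qed

section \<open>A barrier argument\<close>

text \<open>A family of functions stays in the positive orthant if, whenever it is in the orthant
  and one coordinate vanishes, that coordinate is strictly increasing. At the infimum of
  the bad times every coordinate is still nonnegative by continuity; each one is then
  nonnegative for a short while afterwards, by continuity where it is positive and by the
  sign of its derivative where it is zero, against the choice of the infimum.\<close>

lemma nonneg_barrier:
  fixes f f' :: "'a \<Rightarrow> real \<Rightarrow> real"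
  assumes K: "finite K"
    and der: "\<And>k t. k \<in> K \<Longrightarrow> t \<in> {0..1} \<Longrightarrow> (f k has_real_derivative f' k t) (at t within {0..1})"
    and init: "\<And>k. k \<in> K \<Longrightarrow> 0 \<le> f k 0"
    and push: "\<And>k t. k \<in> K \<Longrightarrow> t \<in> {0..1} \<Longrightarrow> (\<And>j. j \<in> K \<Longrightarrow> 0 \<le> f j t) \<Longrightarrow> f k t = 0 \<Longrightarrow> 0 < f' k t"
    and k: "k \<in> K" and t: "t \<in> {0..1}"
  shows "0 \<le> f k t"
proof (rule ccontr)
  assume neg: "\<not> 0 \<le> f k t"
  define B where "B = {u \<in> {0..1}. \<exists>k\<in>K. f k u < 0}"
  have "t \<in> B" using neg k t by (auto simp: B_def not_le)
  have bdd: "bdd_below B" unfolding B_def by (rule bdd_belowI[of _ 0]) auto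
  define s where "s = Inf B"
  have lower: "s \<le> u" if "u \<in> B" for u unfolding s_def using bdd that by (rule cInf_lower[rotated])
  have s0: "0 \<le> s" unfolding s_def using \<open>t \<in> B\<close> by (intro cInf_greatest) (auto simp: B_def)
  have s: "s \<in> {0..1}" using s0 lower[OF \<open>t \<in> B\<close>] t by auto
  have cont: "((\<lambda>u. f k u) \<longlongrightarrow> f k s) (at s within {0..1})" if "k \<in> K" for k
    using DERIV_continuous[OF der[OF that s]] by (simp add: continuous_within)
  have at_s: "0 \<le> f k s" if k: "k \<in> K" for k
  proof (rule ccontr)
    assume "\<not> 0 \<le> f k s"
    then have lt: "f k s < 0" by simp
    then have "0 < s" using init[OF k] s by (cases "s = 0") auto
    from order_tendstoD(2)[OF cont[OF k] lt] obtain d where d: "d > 0"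
      "\<And>u. u \<in> {0..1} \<Longrightarrow> u \<noteq> s \<Longrightarrow> dist u s < d \<Longrightarrow> f k u < 0"
      unfolding eventually_at by auto
    define u where "u = max (s / 2) (s - d / 2)"
    have u: "0 \<le> u" "u < s" "s - u < d" using \<open>0 < s\<close> d by (auto simp: u_def)
    then have "f k u < 0" using s by (intro d) (auto simp: dist_real_def)
    then have "u \<in> B" using u s k by (auto simp: B_def)
    then show False using lower u by force
  qed
  have "eventually (\<lambda>u. 0 \<le> f k u) (at s within {s..1})" if k: "k \<in> K" for k
  proof (cases "f k s = 0")
    case True
    from has_real_derivative_pos_inc_right[OF der[OF k s] push[OF k s at_s True]]
    obtain d where d: "d > 0" "\<And>h. h > 0 \<Longrightarrow> s + h \<in> {0..1} \<Longrightarrow> h < d \<Longrightarrow> f k s < f k (s + h)"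
      by auto
    have "0 \<le> f k u" if "u \<in> {s..1}" "u \<noteq> s" "dist u s < d" for u
      using d(2)[of "u - s"] that s True by (auto simp: dist_real_def)
    then show ?thesis using d(1) unfolding eventually_at by blast
  next
    case False
    then have "0 < f k s" using at_s[OF k] by simp
    from order_tendstoD(1)[OF cont[OF k] this] have "eventually (\<lambda>u. 0 < f k u) (at s within {0..1})" .
    then have "eventually (\<lambda>u. 0 < f k u) (at s within {s..1})"
      by (rule filter_leD[rotated]) (use s in \<open>auto intro: at_le\<close>)
    then show ?thesis by (rule eventually_mono) simp
  qed
  then have "eventually (\<lambda>u. \<forall>k\<in>K. 0 \<le> f k u) (at s within {s..1})"
    using K by (intro eventually_ball_finite) auto
  then obtain d where d: "d > 0" "\<And>u. u \<in> {s..1} \<Longrightarrow> u \<noteq> s \<Longrightarrow> dist u s < d \<Longrightarrow> \<forall>k\<in>K. 0 \<le> f k u"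
    unfolding eventually_at by blast
  have "Inf B < s + d" using d by (simp add: s_def)
  then obtain b where b: "b \<in> B" "b < s + d"
    using \<open>t \<in> B\<close> bdd by (subst (asm) cInf_less_iff) auto
  have "b \<in> {0..1}" "\<exists>k\<in>K. f k b < 0" using b by (auto simp: B_def)
  moreover have "b \<noteq> s" using calculation at_s by force
  ultimately show False
    using d(2)[of b] lower[OF b(1)] b(2) by (force simp: dist_real_def)
qed

lemma has_real_derivative_prod_within:
  fixes f :: "'a \<Rightarrow> real \<Rightarrow> real"
  assumes "finite A" "\<And>i. i \<in> A \<Longrightarrow> (f i has_real_derivative f' i) (at t within S)"
    "\<And>i. i \<in> A \<Longrightarrow> f i t \<noteq> 0"
  shows "((\<lambda>u. \<Prod>i\<in>A. f i u) has_real_derivative (\<Prod>i\<in>A. f i t) * (\<Sum>i\<in>A. f' i / f i t)) (at t within S)"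
  using assms
proof (induction rule: finite_induct)
  case (insert a A)
  have "((\<lambda>u. f a u * (\<Prod>i\<in>A. f i u)) has_real_derivative
     f' a * (\<Prod>i\<in>A. f i t) + (\<Prod>i\<in>A. f i t) * (\<Sum>i\<in>A. f' i / f i t) * f a t) (at t within S)"
    using insert by (intro DERIV_mult) auto
  then show ?case
    using insert by (simp add: algebra_simps)
qed simp

section \<open>Moving the roots\<close>

text \<open>The situation without common roots: the intervals with endpoints \<open>l i\<close> and \<open>m i\<close> are
  nondegenerate and pairwise disjoint. Indices start at \<open>0\<close>.\<close>

locale separated_roots =
  fixes l m :: "nat \<Rightarrow> real" and n :: nat
  assumes ordered: "\<And>i j. i < j \<Longrightarrow> j < n \<Longrightarrow> max (l j) (m j) < min (l i) (m i)"
    and distinct: "\<And>i. i < n \<Longrightarrow> l i \<noteq> m i"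
    and sums: "(\<Sum>i<n. l i) = (\<Sum>i<n. m i)"
begin

definition r :: "real poly" where
  "r = root_poly m {..<n} - root_poly l {..<n}"

definition pencil :: "real \<Rightarrow> real poly" where
  "pencil t = root_poly l {..<n} + smult t r"

definition seg :: "nat \<Rightarrow> real set" where
  "seg i = {min (l i) (m i)..max (l i) (m i)}"

text \<open>For \<open>i \<noteq> j\<close> this is the distance of the two intervals; the branch of the maximum
  that belongs to the wrong order is negative.\<close>

definition gap :: "nat \<Rightarrow> nat \<Rightarrow> real" where
  "gap i j = max (min (l i) (m i) - max (l j) (m j)) (min (l j) (m j) - max (l i) (m i))"

lemma gap_pos: "i < n \<Longrightarrow> j < n \<Longrightarrow> i \<noteq> j \<Longrightarrow> 0 < gap i j"
  using ordered[of i j] ordered[of j i] unfolding gap_def by (cases "i < j") auto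

lemma gap_le: "u \<in> seg i \<Longrightarrow> v \<in> seg j \<Longrightarrow> gap i j \<le> \<bar>u - v\<bar>"
  unfolding gap_def seg_def by auto

lemma seg_ends: "l i \<in> seg i" "m i \<in> seg i"
  by (auto simp: seg_def)

lemma seg_less: "i < j \<Longrightarrow> j < n \<Longrightarrow> u \<in> seg i \<Longrightarrow> v \<in> seg j \<Longrightarrow> v < u"
  using ordered[of i j] by (auto simp: seg_def)

lemma seg_ne: "i < n \<Longrightarrow> j < n \<Longrightarrow> i \<noteq> j \<Longrightarrow> u \<in> seg i \<Longrightarrow> v \<in> seg j \<Longrightarrow> u \<noteq> v"
  using seg_less[of i j u v] seg_less[of j i v u] by (cases "i < j") auto

text \<open>Both polynomials are monic with the same sum of roots, so their two leading
  coefficients cancel.\<close>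

lemma coeff_r_eq_0:
  assumes "n \<le> Suc d"
  shows "coeff r d = 0"
proof -
  consider "n = Suc d" | "n = d" | "n < d" using assms by linarith
  then show ?thesis
  proof cases
    case 1
    then have "card {..<n} = Suc d" by simp
    from coeff_root_poly[OF this, of l] coeff_root_poly[OF this, of m] show ?thesis
      using sums by (simp add: r_def)
  next
    case 2
    have "coeff (root_poly u {..<n}) n = 1" for u :: "nat \<Rightarrow> real"
      using lead_coeff_root_poly[of u "{..<n}"] by (simp add: degree_root_poly)
    then show ?thesis unfolding r_def 2[symmetric] by simp
  next
    case 3
    then show ?thesis by (simp add: r_def coeff_eq_0 degree_root_poly)
  qed
qed

lemma degree_r: "Suc (degree r) < n \<or> r = 0"
  using coeff_r_eq_0[of "degree r"] by (cases "n \<le> Suc (degree r)") auto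

lemma coeff_pencil: "n \<le> d \<Longrightarrow> coeff (pencil t) d = coeff (root_poly l {..<n}) d"
  using coeff_r_eq_0[of d] by (simp add: pencil_def)

lemma degree_pencil: "degree (pencil t) = n"
  and lead_coeff_pencil: "lead_coeff (pencil t) = 1"
proof -
  have top: "coeff (pencil t) n = 1"
    using lead_coeff_root_poly[of l "{..<n}"] by (simp add: coeff_pencil degree_root_poly)
  have "degree (pencil t) \<le> n"
    by (rule degree_le) (simp add: coeff_pencil coeff_eq_0 degree_root_poly)
  moreover have "n \<le> degree (pencil t)" using top by (intro le_degree) simp
  ultimately show d: "degree (pencil t) = n" by simp
  show "lead_coeff (pencil t) = 1" using top by (simp add: d)
qed

lemma pencil_diff: "poly (pencil s) y = poly (pencil t) y + (s - t) * poly r y"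
  by (simp add: pencil_def algebra_simps)

lemma pencil_at_l:
  assumes "i < n"
  shows "poly (pencil t) (l i) = t * (\<Prod>j<n. l i - m j)"
proof -
  have "(\<Prod>j<n. l i - l j) = 0" using assms by auto
  then show ?thesis by (simp add: pencil_def r_def poly_root_poly del: prod_zero_iff)
qed

lemma pencil_at_m:
  assumes "i < n"
  shows "poly (pencil t) (m i) = (1 - t) * (\<Prod>j<n. m i - l j)"
proof -
  have "(\<Prod>j<n. m i - m j) = 0" using assms by auto
  then show ?thesis by (simp add: pencil_def r_def poly_root_poly algebra_simps del: prod_zero_iff)
qed

text \<open>The values at the two ends are \<open>t * q (l i)\<close> and \<open>(1 - t) * p (m i)\<close>. They have opposite
  signs, because in \<open>q (l i) * p (m i)\<close> the factors belonging to any other index \<open>j\<close> agree in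
  sign, the \<open>j\<close>-th interval lying on one side of the \<open>i\<close>-th.\<close>

lemma pencil_root_exists:
  assumes i: "i < n" and t: "t \<in> {0..1}"
  shows "\<exists>y\<in>seg i. poly (pencil t) y = 0"
proof -
  have "(\<Prod>j<n. l i - m j) * (\<Prod>j<n. m i - l j) =
      ((l i - m i) * (m i - l i)) * (\<Prod>j\<in>{..<n} - {i}. (l i - m j) * (m i - l j))"
    using i by (simp add: prod.remove[of "{..<n}" i] prod.distrib)
  also have "\<dots> < 0"
  proof (rule mult_neg_pos)
    show "(l i - m i) * (m i - l i) < 0"
      using distinct[OF i] by (auto simp: mult_less_0_iff)
    show "0 < (\<Prod>j\<in>{..<n} - {i}. (l i - m j) * (m i - l j))"
    proof (rule prod_pos)
      fix j assume "j \<in> {..<n} - {i}"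
      then show "0 < (l i - m j) * (m i - l j)"
        using ordered[of i j] ordered[of j i] i
        by (cases "i < j") (auto simp: zero_less_mult_iff)
    qed
  qed
  finally have opp: "(\<Prod>j<n. l i - m j) * (\<Prod>j<n. m i - l j) < 0" .
  show ?thesis
  proof (cases "t = 0 \<or> t = 1")
    case True
    then have "poly (pencil t) (l i) = 0 \<or> poly (pencil t) (m i) = 0"
      using pencil_at_l[OF i] pencil_at_m[OF i] by auto
    then show ?thesis using seg_ends[of i] by blast
  next
    case False
    then have t': "0 < t * (1 - t)" using t by simp
    have neg: "poly (pencil t) (l i) * poly (pencil t) (m i) < 0"
      using mult_pos_neg[OF t' opp]
      by (simp add: pencil_at_l[OF i] pencil_at_m[OF i] mult_ac)
    consider "l i < m i" | "m i < l i" using distinct[OF i] by linarith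
    then show ?thesis
    proof cases
      case 1
      from poly_IVT[OF this neg] show ?thesis unfolding seg_def by force
    next
      case 2
      from poly_IVT[OF this, of "pencil t"] neg show ?thesis
        unfolding seg_def by (force simp: mult.commute)
    qed
  qed
qed

definition x :: "nat \<Rightarrow> real \<Rightarrow> real" where
  "x i t = (SOME y. y \<in> seg i \<and> poly (pencil t) y = 0)"

context
  fixes t :: real
  assumes t: "t \<in> {0..1}"
begin

lemma x_in_seg: "i < n \<Longrightarrow> x i t \<in> seg i"
  and pencil_x: "i < n \<Longrightarrow> poly (pencil t) (x i t) = 0"
  using someI_ex[of "\<lambda>y. y \<in> seg i \<and> poly (pencil t) y = 0"] pencil_root_exists[of i t] t
  unfolding x_def by blast+

lemma x_decreasing: "i < j \<Longrightarrow> j < n \<Longrightarrow> x j t < x i t"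
  using seg_less x_in_seg by auto

lemma x_inj: "inj_on (\<lambda>i. x i t) {..<n}"
  using seg_ne x_in_seg unfolding inj_on_def by blast

lemma pencil_eq: "pencil t = root_poly (\<lambda>i. x i t) {..<n}"
  by (rule eq_root_polyI) (use x_inj degree_pencil lead_coeff_pencil pencil_x in auto)

lemma poly_pencil: "poly (pencil t) y = (\<Prod>i<n. y - x i t)"
  by (simp add: pencil_eq poly_root_poly)

lemma root_in_seg_unique:
  assumes "i < n" "y \<in> seg i" "poly (pencil t) y = 0"
  shows "x i t = y"
proof -
  obtain j where j: "j < n" "y = x j t" using assms(3) by (auto simp: poly_pencil)
  then show ?thesis using assms seg_ne[of i j y y] x_in_seg[of j] by auto
qed

end

lemma x_0: "i < n \<Longrightarrow> x i 0 = l i"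
  using root_in_seg_unique[of 0 i "l i"] seg_ends pencil_at_l[of i 0] by simp

lemma x_1: "i < n \<Longrightarrow> x i 1 = m i"
  using root_in_seg_unique[of 1 i "m i"] seg_ends pencil_at_m[of i 1] by simp

definition c :: "nat \<Rightarrow> real \<Rightarrow> real" where
  "c i t = residue_at r (\<lambda>i. x i t) {..<n} i"

text \<open>A common root of \<open>r\<close> and one member of the pencil is a root of every member, in
  particular of \<open>p\<close> and of \<open>q\<close>.\<close>

lemma r_nonzero_on_roots:
  assumes "t \<in> {0..1}" "i < n"
  shows "poly r (x i t) \<noteq> 0"
proof
  assume z: "poly r (x i t) = 0"
  have "poly (pencil 0) (x i t) = 0" "poly (pencil 1) (x i t) = 0"
    using pencil_diff[of 0 "x i t" t] pencil_diff[of 1 "x i t" t] pencil_x[OF assms] z by auto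
  then have "x i 0 = x i t" "x i 1 = x i t"
    using root_in_seg_unique x_in_seg[OF assms] assms by auto
  then show False using x_0 x_1 distinct[of i] assms by auto
qed

lemma c_nonzero: "t \<in> {0..1} \<Longrightarrow> i < n \<Longrightarrow> c i t \<noteq> 0"
  using r_nonzero_on_roots prod_diff_nonzero[OF x_inj[of t]]
  unfolding c_def residue_at_def by simp

lemma sum_c: "t \<in> {0..1} \<Longrightarrow> (\<Sum>i<n. c i t) = 0"
  unfolding c_def using degree_r by (intro sum_residues_eq_0 x_inj) auto

text \<open>Evaluating \<open>pencil s\<close> at a root of \<open>pencil t\<close> in two ways, as \<open>(s - t) * r\<close> and as a product
  over the roots of \<open>pencil s\<close>, gives an exact difference quotient for the moving root. It
  replaces the implicit function theorem: since the factors with \<open>j \<noteq> i\<close> are bounded below by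
  the gaps, it yields continuity first and then the derivative.\<close>

lemma x_difference:
  assumes "t \<in> {0..1}" "s \<in> {0..1}" "i < n"
  shows "(x i s - x i t) * (\<Prod>j\<in>{..<n} - {i}. x i t - x j s) = (t - s) * poly r (x i t)"
proof -
  have "(s - t) * poly r (x i t) = (\<Prod>j<n. x i t - x j s)"
    using poly_pencil[OF assms(2)] pencil_x[OF assms(1,3)] pencil_diff[of s "x i t" t] by simp
  also have "\<dots> = (x i t - x i s) * (\<Prod>j\<in>{..<n} - {i}. x i t - x j s)"
    using assms by (simp add: prod.remove[of "{..<n}" i])
  finally show ?thesis by (simp add: algebra_simps)
qed

lemma x_tendsto:
  assumes "t \<in> {0..1}" "i < n"
  shows "(x i \<longlongrightarrow> x i t) (at t within {0..1})"
proof -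
  define g where "g = (\<Prod>j\<in>{..<n} - {i}. gap i j)"
  have g: "0 < g" unfolding g_def using gap_pos assms by (intro prod_pos) auto
  have bound: "\<bar>x i s - x i t\<bar> \<le> \<bar>t - s\<bar> * (\<bar>poly r (x i t)\<bar> / g)" if s: "s \<in> {0..1}" for s
  proof -
    have "g \<le> (\<Prod>j\<in>{..<n} - {i}. \<bar>x i t - x j s\<bar>)"
      unfolding g_def
    proof (rule prod_mono)
      fix j assume "j \<in> {..<n} - {i}"
      then show "0 \<le> gap i j \<and> gap i j \<le> \<bar>x i t - x j s\<bar>"
        using gap_pos[of i j] gap_le x_in_seg assms s by auto
    qed
    then have "\<bar>x i s - x i t\<bar> * g \<le> \<bar>x i s - x i t\<bar> * \<bar>\<Prod>j\<in>{..<n} - {i}. x i t - x j s\<bar>"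
      by (intro mult_left_mono) (auto simp: abs_prod)
    also have "\<dots> = \<bar>t - s\<bar> * \<bar>poly r (x i t)\<bar>"
      using x_difference[OF assms(1) s assms(2)] by (metis abs_mult)
    finally show ?thesis using g by (simp add: field_simps)
  qed
  have "((\<lambda>s. t - s) \<longlongrightarrow> t - t) (at t within {0..1})"
    by (intro tendsto_intros)
  then have to_0: "((\<lambda>s. t - s) \<longlongrightarrow> 0) (at t within {0..1})" by simp
  have "\<forall>\<^sub>F s in at t within {0..1}.
      norm (x i s - x i t) \<le> norm (t - s) * (\<bar>poly r (x i t)\<bar> / g)"
    unfolding eventually_at_filter real_norm_def
    by (rule always_eventually, intro allI impI, rule bound)
  from tendsto_0_le[OF to_0 this]
  have "((\<lambda>s. x i s - x i t) \<longlongrightarrow> 0) (at t within {0..1})" .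
  then show ?thesis by (rule LIM_zero_cancel)
qed

lemma x_derivative:
  assumes t: "t \<in> {0..1}" and i: "i < n"
  shows "(x i has_real_derivative - c i t) (at t within {0..1})"
proof -
  have nz: "(\<Prod>j\<in>{..<n} - {i}. x i t - x j s) \<noteq> 0" if "s \<in> {0..1}" for s
    using seg_ne[of i] x_in_seg t that i by force
  have "((\<lambda>s. - poly r (x i t) / (\<Prod>j\<in>{..<n} - {i}. x i t - x j s)) \<longlongrightarrow>
      - poly r (x i t) / (\<Prod>j\<in>{..<n} - {i}. x i t - x j t)) (at t within {0..1})"
    by (intro tendsto_intros x_tendsto t nz) auto
  moreover have "\<forall>\<^sub>F s in at t within {0..1}.
      - poly r (x i t) / (\<Prod>j\<in>{..<n} - {i}. x i t - x j s) = (x i s - x i t) / (s - t)"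
  proof -
    have "- poly r (x i t) / (\<Prod>j\<in>{..<n} - {i}. x i t - x j s) = (x i s - x i t) / (s - t)"
      if "s \<in> {0..1}" "s \<noteq> t" for s
      using x_difference[OF t that(1) i] nz[OF that(1)] that(2)
      by (simp add: field_simps)
    then show ?thesis by (auto simp: eventually_at_filter)
  qed
  ultimately have "((\<lambda>s. (x i s - x i t) / (s - t)) \<longlongrightarrow>
      - poly r (x i t) / (\<Prod>j\<in>{..<n} - {i}. x i t - x j t)) (at t within {0..1})"
    by (rule Lim_transform_eventually)
  then show ?thesis
    by (simp add: has_field_derivative_iff c_def residue_at_def)
qed

text \<open>The quotient rule produces \<open>- c i * \<Sum>j. (c i + c j) / (x i - x j)\<close> from the numerator, by
  \<open>pderiv_at_node\<close>, and \<open>- c i * \<Sum>j. (c j - c i) / (x i - x j)\<close> from the denominator. The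
  terms quadratic in \<open>c i\<close> cancel.\<close>

lemma c_derivative:
  assumes t: "t \<in> {0..1}" and i: "i < n"
  shows "(c i has_real_derivative - 2 * (\<Sum>j\<in>{..<n} - {i}. c i t * c j t / (x i t - x j t)))
    (at t within {0..1})"
proof -
  define A where "A = {..<n} - {i}"
  define V where "V = (\<Prod>j\<in>A. x i t - x j t)"
  define R where "R = poly r (x i t)"
  have V0: "V \<noteq> 0" unfolding V_def A_def
    using prod_diff_nonzero[OF x_inj[OF t]] i by simp
  have ne: "x i t - x j t \<noteq> 0" if "j \<in> A" for j
    using x_inj[OF t] that i by (auto simp: inj_on_def A_def)
  have R: "R = c i t * V" using V0 by (simp add: R_def V_def c_def A_def residue_at_def)
  have deg: "degree r < card {..<n}" using degree_r i by auto
  have r': "poly (pderiv r) (x i t) = V * (\<Sum>j\<in>A. (c i t + c j t) / (x i t - x j t))"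
    using pderiv_at_node[OF _ x_inj[OF t] deg, of i] i unfolding V_def A_def c_def by simp
  have dV: "((\<lambda>s. \<Prod>j\<in>A. x i s - x j s) has_real_derivative
      V * (\<Sum>j\<in>A. (- c i t - - c j t) / (x i t - x j t))) (at t within {0..1})"
    unfolding V_def using ne i t
    by (intro has_real_derivative_prod_within DERIV_diff x_derivative) (auto simp: A_def)
  have dR: "((\<lambda>s. poly r (x i s)) has_real_derivative poly (pderiv r) (x i t) * - c i t)
      (at t within {0..1})"
    using DERIV_chain[OF poly_DERIV x_derivative[OF t i]] by (simp add: o_def)
  have "((\<lambda>s. poly r (x i s) / (\<Prod>j\<in>A. x i s - x j s)) has_real_derivative
      (poly (pderiv r) (x i t) * - c i t * V - R * (V * (\<Sum>j\<in>A. (- c i t - - c j t) / (x i t - x j t)))) / (V * V))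
      (at t within {0..1})"
    using DERIV_divide[OF dR dV] V0 unfolding V_def R_def by simp
  moreover have "(poly (pderiv r) (x i t) * - c i t * V - R * (V * (\<Sum>j\<in>A. (- c i t - - c j t) / (x i t - x j t)))) / (V * V)
      = - c i t * ((\<Sum>j\<in>A. (c i t + c j t) / (x i t - x j t)) + (\<Sum>j\<in>A. (- c i t - - c j t) / (x i t - x j t)))"
    using V0 by (simp add: R r' field_simps)
  moreover have "\<dots> = - 2 * (\<Sum>j\<in>A. c i t * c j t / (x i t - x j t))"
    unfolding sum.distrib[symmetric] sum_distrib_left
    by (intro sum.cong refl) (simp add: add_divide_distrib[symmetric] diff_divide_distrib[symmetric] algebra_simps)
  moreover have "c i = (\<lambda>s. poly r (x i s) / (\<Prod>j\<in>A. x i s - x j s))"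
    by (simp add: fun_eq_iff c_def residue_at_def A_def)
  ultimately show ?thesis unfolding A_def by simp
qed

text \<open>Here \<open>S k\<close> is minus the rate of change of the sum of the first \<open>k\<close> moving roots. The
  barrier argument is run for \<open>0 < k < n\<close>, as \<open>S 0\<close> and \<open>S n\<close> vanish identically.\<close>

lemma x_partial_sum_le:
  assumes partial: "\<And>k. k < n \<Longrightarrow> 0 \<le> (\<Sum>i<k. c i 0)" and k: "k \<le> n"
  shows "(\<Sum>i<k. m i) \<le> (\<Sum>i<k. l i)"
proof -
  define S where "S k t = (\<Sum>i<k. c i t)" for k t
  define S' where "S' k t = (\<Sum>i<k. - 2 * (\<Sum>j\<in>{..<n} - {i}. c i t * c j t / (x i t - x j t)))" for k t
  have S_n: "S n t = 0" if "t \<in> {0..1}" for t using sum_c[OF that] by (simp add: S_def)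
  have S'_eq: "S' k t = - 2 * (\<Sum>i<k. \<Sum>j\<in>{k..<n}. c i t * c j t / (x i t - x j t))"
    if k: "k \<le> n" for k t
  proof -
    \<comment> \<open>The terms with both indices below \<open>k\<close> cancel in pairs, by antisymmetry; including the
      diagonal does no harm, as division by zero yields zero there.\<close>
    define w where "w i j = c i t * c j t / (x i t - x j t)" for i j
    have anti: "w i j = - w j i" for i j
    proof -
      have "x j t - x i t = - (x i t - x j t)" by simp
      then show ?thesis by (simp only: w_def divide_minus_right minus_minus mult.commute)
    qed
    have diag: "w i i = 0" for i by (simp add: w_def)
    have "(\<Sum>i<k. \<Sum>j<k. w i j) = (\<Sum>i<k. \<Sum>j<k. - w j i)"
      by (intro sum.cong refl anti)
    also have "\<dots> = - (\<Sum>j<k. \<Sum>i<k. w j i)" by (subst sum.swap) (simp add: sum_negf)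
    finally have inner: "(\<Sum>i<k. \<Sum>j<k. w i j) = 0" by simp
    have "(\<Sum>i<k. \<Sum>j\<in>{..<n} - {i}. w i j) = (\<Sum>i<k. \<Sum>j<n. w i j)"
    proof (rule sum.cong[OF refl])
      fix i assume "i \<in> {..<k}"
      then have "i \<in> {..<n}" using k by simp
      from sum.remove[OF _ this, of "w i"] show "(\<Sum>j\<in>{..<n} - {i}. w i j) = (\<Sum>j<n. w i j)"
        by (simp add: diag)
    qed
    also have "\<dots> = (\<Sum>i<k. (\<Sum>j<k. w i j) + (\<Sum>j\<in>{k..<n}. w i j))"
    proof (rule sum.cong[OF refl])
      fix i
      show "(\<Sum>j<n. w i j) = (\<Sum>j<k. w i j) + (\<Sum>j\<in>{k..<n}. w i j)"
        using sum.atLeastLessThan_concat[of 0 k n "w i"] k by (simp add: atLeast0LessThan)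
    qed
    also have "\<dots> = (\<Sum>i<k. \<Sum>j\<in>{k..<n}. w i j)"
      by (simp add: sum.distrib inner)
    finally have "- 2 * (\<Sum>i<k. \<Sum>j\<in>{..<n} - {i}. w i j) =
      - 2 * (\<Sum>i<k. \<Sum>j\<in>{k..<n}. w i j)" by (rule arg_cong)
    moreover have "S' k t = - 2 * (\<Sum>i<k. \<Sum>j\<in>{..<n} - {i}. w i j)"
      unfolding S'_def w_def by (rule sum_distrib_left[symmetric])
    ultimately show ?thesis unfolding w_def by (rule trans[rotated])
  qed
  have S_nonneg: "0 \<le> S k t" if "k \<in> {1..<n}" "t \<in> {0..1}" for k t
  proof (rule nonneg_barrier[where K = "{1..<n}" and f = S and f' = S', OF _ _ _ _ that])
    show "(S k has_real_derivative S' k t) (at t within {0..1})"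
      if "k \<in> {1..<n}" "t \<in> {0..1}" for k t
      unfolding S_def S'_def using that by (intro DERIV_sum c_derivative) auto
    show "0 \<le> S k 0" if "k \<in> {1..<n}" for k using partial[of k] that by (simp add: S_def)
    show "0 < S' k t"
      if k: "k \<in> {1..<n}" and t: "t \<in> {0..1}" and nonneg: "\<And>j. j \<in> {1..<n} \<Longrightarrow> 0 \<le> S j t"
        and zero: "S k t = 0" for k t
    proof -
      have all: "0 \<le> S j t" if "j \<le> n" for j
        using nonneg[of j] S_n[OF t] that by (cases "j = 0 \<or> j = n") (auto simp: S_def)
      have "(\<Sum>i<k. \<Sum>j\<in>{k..<n}. c i t * c j t / (x i t - x j t)) < 0"
        using all S_n[OF t] zero k c_nonzero[OF t] x_decreasing[OF t]
        by (intro cross_sum_neg) (auto simp: S_def)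
      then show ?thesis using k by (simp add: S'_eq)
    qed
  qed simp
  have nonneg: "0 \<le> S k t" if "t \<in> {0..1}" for t
    using S_nonneg[of k t] S_n[OF that] k that by (cases "k = 0 \<or> k = n") (auto simp: S_def)
  have der: "((\<lambda>t. \<Sum>i<k. x i t) has_real_derivative - S k t) (at t within {0..1})"
    if "t \<in> {0..1}" for t
    unfolding S_def sum_negf[symmetric] using that k by (intro DERIV_sum x_derivative) auto
  have "(\<Sum>i<k. x i 1) \<le> (\<Sum>i<k. x i 0)"
  proof (rule DERIV_nonpos_imp_decreasing_open[of 0 1 "\<lambda>t. \<Sum>i<k. x i t"])
    show "continuous_on {0..1} (\<lambda>t. \<Sum>i<k. x i t)"
      using DERIV_continuous[OF der] by (simp add: continuous_on_eq_continuous_within)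
    fix t :: real assume t: "0 < t" "t < 1"
    then have "((\<lambda>t. \<Sum>i<k. x i t) has_real_derivative - S k t) (at t)"
      using der[of t] at_within_Icc_at[of 0 t 1] by simp
    then show "\<exists>y. ((\<lambda>t. \<Sum>i<k. x i t) has_real_derivative y) (at t) \<and> y \<le> 0"
      using nonneg[of t] t by force
  qed simp
  then show ?thesis using k x_0 x_1 by simp
qed

lemma partial_sum_le:
  assumes "\<And>k. k < n \<Longrightarrow> 0 \<le> (\<Sum>i<k. residue_at (root_poly m {..<n}) l {..<n} i)" and "k \<le> n"
  shows "(\<Sum>i<k. m i) \<le> (\<Sum>i<k. l i)"
proof (rule x_partial_sum_le)
  fix k assume k: "k < n"
  have "c i 0 = residue_at (root_poly m {..<n}) l {..<n} i" if i: "i < n" for i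
  proof -
    have "poly r (l i) = poly (root_poly m {..<n}) (l i)"
      using i by (auto simp: r_def poly_root_poly)
    moreover have "(\<Prod>j\<in>{..<n} - {i}. x i 0 - x j 0) = (\<Prod>j\<in>{..<n} - {i}. l i - l j)"
      using i x_0 by (intro prod.cong) auto
    ultimately show ?thesis using i x_0 by (simp add: c_def residue_at_def)
  qed
  then show "0 \<le> (\<Sum>i<k. c i 0)" using assms(1)[OF k] k by simp
qed fact

end

section \<open>Removing common roots\<close>

text \<open>The increasing enumeration of the indices other than \<open>a\<close>.\<close>

definition skip :: "nat \<Rightarrow> nat \<Rightarrow> nat" where
  "skip a i = (if i < a then i else Suc i)"

lemma bij_betw_skip: "a \<le> n \<Longrightarrow> bij_betw (skip a) {..<n} ({..<Suc n} - {a})"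
  by (rule bij_betwI[where g = "\<lambda>i. if i < a then i else i - 1"]) (auto simp: skip_def split: if_splits)

lemma sum_skip:
  fixes f :: "nat \<Rightarrow> real"
  shows "(\<Sum>i<k. f (skip a i)) = (if k \<le> a then \<Sum>i<k. f i else (\<Sum>i<Suc k. f i) - f a)"
  by (induction k) (auto simp: skip_def not_less_eq_eq dest: le_antisym)

text \<open>The factor \<open>y - l a = y - m b\<close> cancels from \<open>q / p\<close>, so the residues at the other poles
  are those of the reduced pair.\<close>

lemma residue_at_skip:
  fixes l m :: "nat \<Rightarrow> real"
  assumes ab: "a \<le> n" "b \<le> n" "l a = m b" and i: "i < n" and inj: "inj_on l {..<Suc n}"
  shows "residue_at (root_poly (\<lambda>j. m (skip b j)) {..<n}) (\<lambda>j. l (skip a j)) {..<n} i =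
    residue_at (root_poly m {..<Suc n}) l {..<Suc n} (skip a i)"
proof -
  let ?s = "skip a i"
  have s: "?s \<in> {..<Suc n} - {a}" using bij_betw_skip[OF ab(1)] i by (auto simp: bij_betw_def)
  then have ne: "l ?s - l a \<noteq> 0" using inj ab by (auto simp: inj_on_def)
  have num: "(\<Prod>j<Suc n. l ?s - m j) = (l ?s - l a) * (\<Prod>j<n. l ?s - m (skip b j))"
    using prod.remove[of "{..<Suc n}" b "\<lambda>j. l ?s - m j"] ab
      prod.reindex_bij_betw[OF bij_betw_skip[OF ab(2)], of "\<lambda>j. l ?s - m j"] by simp
  have swap: "{..<Suc n} - {a} - {?s} = {..<Suc n} - {?s} - {a}" by blast
  have "bij_betw (skip a) ({..<n} - {i}) ({..<Suc n} - {a} - {?s})"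
    using bij_betw_DiffI[OF bij_betw_skip[OF ab(1)], of "{i}" "{?s}"] i s
    by (auto simp: bij_betw_def)
  from prod.reindex_bij_betw[OF this, of "\<lambda>j. l ?s - l j"]
  have "(\<Prod>j\<in>{..<Suc n} - {?s}. l ?s - l j) = (l ?s - l a) * (\<Prod>j\<in>{..<n} - {i}. l ?s - l (skip a j))"
    using prod.remove[of "{..<Suc n} - {?s}" a "\<lambda>j. l ?s - l j"] ab s swap by simp
  then show ?thesis
    using num ne by (simp add: residue_at_def poly_root_poly)
qed

text \<open>Induction on the number of roots. If \<open>l a = m b\<close>, interlacing forces \<open>a\<close> and \<open>b\<close> to be equal
  or adjacent, and this is what keeps the reduced sequences interlaced. The residue at
  \<open>l a\<close> is zero, so the partial sums of residues also stay nonnegative. The inequality for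
  the reduced pair is the desired one whenever \<open>k\<close> counts both or neither of the two removed
  entries. If \<open>k\<close> counts only one of them, then \<open>k\<close> is the larger of \<open>a\<close> and \<open>b\<close>, and the
  inequality follows from the one with both removed entries counted (\<open>b = Suc a\<close>) or with
  neither counted (\<open>a = Suc b\<close>), as \<open>l\<close> is strictly decreasing.\<close>

lemma interlaced_partial_sum_le:
  fixes l m :: "nat \<Rightarrow> real"
  assumes "\<And>i j. i < j \<Longrightarrow> j < n \<Longrightarrow> l j < l i"
    and "\<And>i j. i < j \<Longrightarrow> j < n \<Longrightarrow> m j < m i"
    and "\<And>i j. i < j \<Longrightarrow> j < n \<Longrightarrow> l j \<le> m i"
    and "\<And>i j. i < j \<Longrightarrow> j < n \<Longrightarrow> m j \<le> l i"
    and "(\<Sum>i<n. l i) = (\<Sum>i<n. m i)"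
    and "\<And>k. k < n \<Longrightarrow> 0 \<le> (\<Sum>i<k. residue_at (root_poly m {..<n}) l {..<n} i)"
    and "k \<le> n"
  shows "(\<Sum>i<k. m i) \<le> (\<Sum>i<k. l i)"
  using assms
proof (induction n arbitrary: l m k)
  case 0
  then show ?case by simp
next
  case (Suc n)
  note l = Suc.prems(1) and m = Suc.prems(2) and lm = Suc.prems(3) and ml = Suc.prems(4)
    and sums = Suc.prems(5) and partial = Suc.prems(6) and k = Suc.prems(7)
  show ?case
  proof (cases "\<exists>a\<le>n. \<exists>b\<le>n. l a = m b")
    case False
    then have ne: "l a \<noteq> m b" if "a < Suc n" "b < Suc n" for a b using that by auto
    have "separated_roots l m (Suc n)"
    proof
      fix i j assume ij: "i < j" "j < Suc n"
      have "l j < m i" "m j < l i" using lm[OF ij] ml[OF ij] ne[of j i] ne[of i j] ij by auto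
      then show "max (l j) (m j) < min (l i) (m i)" using l[OF ij] m[OF ij] by simp
    qed (use ne sums in auto)
    then show ?thesis using separated_roots.partial_sum_le[of l m "Suc n" k] partial k by blast
  next
    case True
    then obtain a b where ab: "a \<le> n" "b \<le> n" "l a = m b" by blast
    have b_le: "b \<le> Suc a"
      using m[of "Suc a" b] ml[of a "Suc a"] ab by (cases "Suc a < b") auto
    have a_le: "a \<le> Suc b"
      using l[of "Suc b" a] lm[of b "Suc b"] ab by (cases "Suc b < a") auto
    have inj: "inj_on l {..<Suc n}"
      using l by (intro linorder_inj_onI) (force+)
    define l' where "l' i = l (skip a i)" for i
    define m' where "m' i = m (skip b i)" for i
    have less: "skip u i < skip v j" if "i < j" "u \<le> Suc v" "v \<le> Suc u" for u v i j
      using that by (auto simp: skip_def)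
    have bound: "skip u j < Suc n" if "j < n" for u j using that by (auto simp: skip_def)
    have sum_l': "(\<Sum>i<j. l' i) = (if j \<le> a then \<Sum>i<j. l i else (\<Sum>i<Suc j. l i) - l a)" for j
      unfolding l'_def by (rule sum_skip)
    have sum_m': "(\<Sum>i<j. m' i) = (if j \<le> b then \<Sum>i<j. m i else (\<Sum>i<Suc j. m i) - m b)" for j
      unfolding m'_def by (rule sum_skip)
    have IH: "(\<Sum>i<j. m' i) \<le> (\<Sum>i<j. l' i)" if "j \<le> n" for j
    proof (rule Suc.IH[OF _ _ _ _ _ _ that])
      fix i j assume ij: "i < j" "j < n"
      show "l' j < l' i" unfolding l'_def using less[OF ij(1)] bound[OF ij(2)] by (intro l) auto
      show "m' j < m' i" unfolding m'_def using less[OF ij(1)] bound[OF ij(2)] by (intro m) auto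
      show "l' j \<le> m' i" unfolding l'_def m'_def
        using less[OF ij(1)] bound[OF ij(2)] a_le b_le by (intro lm) auto
      show "m' j \<le> l' i" unfolding l'_def m'_def
        using less[OF ij(1)] bound[OF ij(2)] a_le b_le by (intro ml) auto
    next
      show "(\<Sum>i<n. l' i) = (\<Sum>i<n. m' i)"
        unfolding sum_l' sum_m' using sums ab by (cases "n \<le> a"; cases "n \<le> b") auto
    next
      fix j assume j: "j < n"
      let ?c = "residue_at (root_poly m {..<Suc n}) l {..<Suc n}"
      have "(\<Prod>j<Suc n. l a - m j) = 0" using ab by (intro prod_zero) auto
      then have c_a: "?c a = 0" by (simp only: residue_at_def poly_root_poly div_0)
      have "(\<Sum>i<j. residue_at (root_poly m' {..<n}) l' {..<n} i) = (\<Sum>i<j. ?c (skip a i))"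
        unfolding l'_def m'_def using j ab inj by (intro sum.cong refl residue_at_skip) auto
      also have "\<dots> \<ge> 0"
        unfolding sum_skip using partial[of j] partial[of "Suc j"] c_a j by auto
      finally show "0 \<le> (\<Sum>i<j. residue_at (root_poly m' {..<n}) l' {..<n} i)" .
    qed
    consider "k \<le> a" "k \<le> b" | "a < k" "b < k" | "k = b" "b = Suc a" | "k = a" "a = Suc b"
      using a_le b_le by linarith
    then show ?thesis
    proof cases
      case 1
      then show ?thesis using IH[of k] ab by (simp add: sum_l' sum_m')
    next
      case 2
      then obtain j where "k = Suc j" by (cases k) auto
      then have "(\<Sum>i<j. l' i) = (\<Sum>i<k. l i) - l a" "(\<Sum>i<j. m' i) = (\<Sum>i<k. m i) - m b"
        using 2 by (cases "j = a"; cases "j = b"; simp add: sum_l' sum_m')+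
      then show ?thesis using IH[of j] \<open>k = Suc j\<close> k ab by simp
    next
      case 3
      then have "(\<Sum>i<k. l' i) = (\<Sum>i<Suc k. l i) - l a" "(\<Sum>i<k. m' i) = (\<Sum>i<k. m i)"
        by (simp_all add: sum_l' sum_m' del: sum.lessThan_Suc)
      then show ?thesis using IH[of k] l[of a b] sum.lessThan_Suc[of l k] 3 ab
        by (simp del: sum.lessThan_Suc)
    next
      case 4
      then show ?thesis using IH[of b] l[of b a] ab by (simp add: sum_l' sum_m')
    qed
  qed
qed

section \<open>From root sequences to polynomials\<close>

lemma ordered_root_strict:
  assumes p: "real_rooted p" "rsquarefree p" and ij: "i < j" "j < degree p"
  shows "ordered_root p (Suc j) < ordered_root p (Suc i)"
proof -
  have "count (proots p) a = (if a \<in># proots p then 1 else 0)" for a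
  proof -
    have "order a p = 0 \<or> order a p = 1" "p \<noteq> 0" using p(2) unfolding rsquarefree_def by blast+
    then have "count (proots p) a = 0 \<or> count (proots p) a = 1" by simp
    then show ?thesis by (metis count_eq_zero_iff zero_neq_one)
  qed
  then have "distinct (root_list p)"
    unfolding root_list_def by (simp add: distinct_count_atmost_1)
  moreover have "sorted_wrt (\<ge>) (root_list p)"
    by (simp add: root_list_def sorted_wrt_rev)
  ultimately show ?thesis
    using ij length_root_list[OF p(1)]
    by (force simp: ordered_root_def sorted_wrt_iff_nth_less nth_eq_iff_index_eq order.strict_iff_order)
qed

lemma eq_root_poly_ordered_root:
  assumes p: "real_rooted p" "rsquarefree p" "lead_coeff p = 1"
  shows "p = root_poly (\<lambda>i. ordered_root p (Suc i)) {..<degree p}"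
proof (rule eq_root_polyI)
  show "inj_on (\<lambda>i. ordered_root p (Suc i)) {..<degree p}"
    using ordered_root_strict[OF p(1,2)] by (intro linorder_inj_onI) (force+)
  fix i assume "i \<in> {..<degree p}"
  then have "ordered_root p (Suc i) \<in> set (root_list p)"
    using length_root_list[OF p(1)] by (simp add: ordered_root_def)
  then show "poly p (ordered_root p (Suc i)) = 0"
    using p by (simp add: root_list_def real_rooted_def)
qed (use p in auto)

theorem theorem1p5:
  fixes p q :: "real poly" and n :: nat
  assumes "lead_coeff p = 1" and "lead_coeff q = 1"
    and "degree p = n" and "degree q = n"
    and "real_rooted p" and "real_rooted q"
    and "rsquarefree p" and "rsquarefree q"
    and "common_interlacer p q"
    and "(\<Sum>i=1..n. ordered_root p i) = (\<Sum>i=1..n. ordered_root q i)"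
    and "\<And>k. 1 \<le> k \<Longrightarrow> k < n \<Longrightarrow>
      (\<Sum>i=1..k. poly q (ordered_root p i) / poly (pderiv p) (ordered_root p i)) \<ge> 0"
  shows "poly_majorizes p q"
proof -
  define l where "l i = ordered_root p (Suc i)" for i
  define m where "m i = ordered_root q (Suc i)" for i
  let ?c = "residue_at (root_poly m {..<n}) l {..<n}"
  have shift: "(\<Sum>i=1..k. f i) = (\<Sum>i<k. f (Suc i))" for f :: "nat \<Rightarrow> real" and k
    by (simp add: sum.atLeast1_atMost_eq)
  have l: "l j < l i" if "i < j" "j < n" for i j
    unfolding l_def using assms that by (intro ordered_root_strict) auto
  have m: "m j < m i" if "i < j" "j < n" for i j
    unfolding m_def using assms that by (intro ordered_root_strict) auto
  have p: "p = root_poly l {..<n}" and q: "q = root_poly m {..<n}"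
    using eq_root_poly_ordered_root[of p] eq_root_poly_ordered_root[of q] assms
    unfolding l_def m_def by auto
  have cross: "l (Suc i) \<le> m i" "m (Suc i) \<le> l i" if "Suc i < n" for i
    using assms(9) that assms(3) unfolding common_interlacer_def l_def m_def
    by (auto dest: spec[of _ "Suc i"])
  have c_eq: "poly q (l i) / poly (pderiv p) (l i) = ?c i" if "i < n" for i
    using that pderiv_root_poly_at_root[of "{..<n}" i l] by (simp add: p q residue_at_def)
  have sums: "(\<Sum>i<n. l i) = (\<Sum>i<n. m i)" using assms(10) unfolding shift l_def m_def .
  have partial: "0 \<le> (\<Sum>i<k. ?c i)" if k: "k < n" for k
  proof -
    have "(\<Sum>i<k. ?c i) = (\<Sum>i=1..k. poly q (ordered_root p i) / poly (pderiv p) (ordered_root p i))"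
      unfolding shift l_def[symmetric] using k by (intro sum.cong refl c_eq[symmetric]) auto
    then show ?thesis using assms(11)[of k] k by (cases "k = 0") auto
  qed
  have le: "(\<Sum>i<k. m i) \<le> (\<Sum>i<k. l i)" if "k \<le> n" for k
  proof (rule interlaced_partial_sum_le[OF l m _ _ sums partial that])
    fix i j assume ij: "i < j" "j < n"
    have "l j \<le> l (Suc i)" "m j \<le> m (Suc i)"
      using l[of "Suc i" j] m[of "Suc i" j] ij by (cases "j = Suc i"; force)+
    then show "l j \<le> m i" "m j \<le> l i" using cross[of i] ij by auto
  qed
  show ?thesis
    using assms(3-6) le sums unfolding poly_majorizes_def vec_majorizes_def shift l_def m_def by simp
qed

end
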